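(* Proper mutations and wiggles preserve the integral congruence class of a unipotent companion of a cyclically ordered quiver. That is, if a cyclically ordered quiver $(Q',\sigma')$ on $n$ vertices is obtained from a cyclically ordered quiver $(Q,\sigma)$ by a wiggle or by a proper mutation at a proper vertex, and $U$ (resp., $U'$) is the unipotent companion of $Q$ (resp., $Q'$) with respect to a linear ordering compatible with $\sigma$ (resp., $\sigma'$), then there exists $G\in\operatorname{GL}_n(\mathbb Z)$ such that $U'=GUG^T$.
   Context: A quiver is a finite directed graph without loops or oriented 2-cycles; multiple arrows are allowed. Mutation $\mu_j$ of a quiver at a vertex $j$: for each path $i\to j\to k$ add an arrow $i\to k$; reverse all arrows incident to $j$; repeatedly remove oriented 2-cycles. A cyclic ordering $\sigma=(v_1,\dots,v_n)$ of the vertex set is a linear ordering $v_1<\dots<v_n$ considered up to cyclic shifts ("clockwise" placement on a circle); the $n$ linear orderings in this class are called compatible with $\sigma$. A cyclically ordered quiver (COQ) $(Q,\sigma)$ is a quiver with a cyclic ordering of its vertices. A wiggle transforms $(Q,\sigma)$ into $(Q,\sigma')$ where $\sigma'$ is obtained from $\sigma$ by interchanging two vertices that are consecutive in $\sigma$ and not adjacent in $Q$. A path $i\to j\to k$ in $Q$ makes a right turn at $j$ if $\sigma=(\dots,i,\dots,j,\dots,k,\dots)$. A vertex $j$ is proper in $(Q,\sigma)$ if every oriented two-arrow path $i\to j\to k$ in $Q$ makes a right turn at $j$. Let $\operatorname{In}(j)$ (resp., $\operatorname{Out}(j)$) be the set of vertices $i$ with an arrow $i\to j$ (resp., $j\to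 i$) in $Q$. If $j$ is proper, the proper mutation $\mu_j(Q,\sigma)$ is the quiver $\mu_j(Q)$ with the cyclic ordering obtained from $\sigma$ by keeping the placement of all vertices other than $j$ and moving $j$ clockwise past all the vertices in $\operatorname{Out}(j)$ (each exactly once) without passing any vertex in $\operatorname{In}(j)$. This placement is well defined up to wiggles of the mutated COQ; for a sink or source $j$ the cyclic ordering does not change (up to wiggles). Given a linear ordering $v_1<\dots<v_n$ of the vertices, the exchange matrix $B=(b_{ij})$ is the skew-symmetric integer matrix with $b_{ij}=x$ if $Q$ contains $x\ge0$ arrows $v_i\to v_j$ and $b_{ij}=-x$ if $Q$ contains $x\ge 0$ arrows $v_j\to v_i$. The unipotent companion of $Q$ is the unique unipotent upper-triangular matrix $U$ with $-B=U-U^T$. Its integral congruence class ($L\sim GLG^T$, $G\in \operatorname{GL}_n(\mathbb Z)$) does not depend on the choice of a compatible linear ordering for a given cyclic ordering. *)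

theory Defs
  imports "Jordan_Normal_Form.Matrix"
begin

text \<open>A directed multigraph up to isomorphism fixing the vertices: \<open>arr Q i j\<close> is the
  number of arrows from \<open>i\<close> to \<open>j\<close>.\<close>

record 'v quiver =
  verts :: "'v set"
  arr :: "'v \<Rightarrow> 'v \<Rightarrow> nat"

definition is_quiver :: "'v quiver \<Rightarrow> bool" where
  "is_quiver Q \<longleftrightarrow> finite (verts Q)
     \<and> (\<forall>i j. arr Q i j > 0 \<longrightarrow> i \<in> verts Q \<and> j \<in> verts Q)
     \<and> (\<forall>i. arr Q i i = 0)
     \<and> (\<forall>i j. arr Q i j > 0 \<longrightarrow> arr Q j i = 0)"

definition In_verts :: "'v quiver \<Rightarrow> 'v \<Rightarrow> 'v set" where
  "In_verts Q j = {i \<in> verts Q. arr Q i j > 0}"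

definition Out_verts :: "'v quiver \<Rightarrow> 'v \<Rightarrow> 'v set" where
  "Out_verts Q j = {i \<in> verts Q. arr Q j i > 0}"

text \<open>The number of paths \<open>i \<rightarrow> j \<rightarrow> k\<close> is \<open>arr Q i j * arr Q j k\<close>. In the last step, truncated
  subtraction leaves what remains after removing as many 2-cycles as possible.\<close>

definition add_paths :: "'v \<Rightarrow> 'v quiver \<Rightarrow> 'v quiver" where
  "add_paths j Q = Q\<lparr>arr := \<lambda>i k. arr Q i k + arr Q i j * arr Q j k\<rparr>"

definition reverse_at :: "'v \<Rightarrow> 'v quiver \<Rightarrow> 'v quiver" where
  "reverse_at j Q = Q\<lparr>arr := \<lambda>i k. if i = j \<or> k = j then arr Q k i else arr Q i k\<rparr>"

definition cancel_2cycles :: "'v quiver \<Rightarrow> 'v quiver" where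
  "cancel_2cycles Q = Q\<lparr>arr := \<lambda>i k. arr Q i k - arr Q k i\<rparr>"

definition mutate :: "'v \<Rightarrow> 'v quiver \<Rightarrow> 'v quiver" where
  "mutate j Q = cancel_2cycles (reverse_at j (add_paths j Q))"

text \<open>A linear ordering \<open>v\<^sub>1 < \<dots> < v\<^sub>n\<close> of \<open>V\<close> is the list \<open>[v\<^sub>1, \<dots>, v\<^sub>n]\<close>. A cyclic ordering is
  identified with the set of linear orderings compatible with it, and lists are read
  clockwise.\<close>

definition linear_ordering :: "'v set \<Rightarrow> 'v list \<Rightarrow> bool" where
  "linear_ordering V vs \<longleftrightarrow> distinct vs \<and> set vs = V"

definition cyclic_class :: "'v list \<Rightarrow> 'v list set" where
  "cyclic_class vs = {rotate m vs | m. True}"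

definition cyclic_ordering :: "'v set \<Rightarrow> 'v list set \<Rightarrow> bool" where
  "cyclic_ordering V \<sigma> \<longleftrightarrow> (\<exists>vs. linear_ordering V vs \<and> \<sigma> = cyclic_class vs)"

type_synonym 'v coq = "'v quiver \<times> 'v list set"

definition is_coq :: "'v coq \<Rightarrow> bool" where
  "is_coq = (\<lambda>(Q, \<sigma>). is_quiver Q \<and> cyclic_ordering (verts Q) \<sigma>)"

text \<open>Any two cyclically consecutive vertices are the first two entries of some compatible
  linear ordering.\<close>

definition wiggle :: "'v coq \<Rightarrow> 'v coq \<Rightarrow> bool" where
  "wiggle = (\<lambda>(Q, \<sigma>) (Q', \<sigma>'). Q' = Q \<and>
     (\<exists>u v ws. u # v # ws \<in> \<sigma> \<and> arr Q u v = 0 \<and> arr Q v u = 0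
        \<and> \<sigma>' = cyclic_class (v # u # ws)))"

definition right_turn :: "'v list set \<Rightarrow> 'v \<Rightarrow> 'v \<Rightarrow> 'v \<Rightarrow> bool" where
  "right_turn \<sigma> i j k \<longleftrightarrow> (\<exists>ws xs ys zs. ws @ i # xs @ j # ys @ k # zs \<in> \<sigma>)"

definition proper_vertex :: "'v coq \<Rightarrow> 'v \<Rightarrow> bool" where
  "proper_vertex = (\<lambda>(Q, \<sigma>) j. j \<in> verts Q \<and>
     (\<forall>i k. arr Q i j > 0 \<and> arr Q j k > 0 \<longrightarrow> right_turn \<sigma> i j k))"

text \<open>A relation rather than a function, because the new placement of \<open>j\<close> is determined only
  up to wiggles; every admissible placement is allowed. Here \<open>xs\<close> lists the vertices that
  \<open>j\<close> passes on its way clockwise.\<close>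

definition proper_mutation :: "'v \<Rightarrow> 'v coq \<Rightarrow> 'v coq \<Rightarrow> bool" where
  "proper_mutation j = (\<lambda>(Q, \<sigma>) (Q', \<sigma>'). proper_vertex (Q, \<sigma>) j \<and> Q' = mutate j Q \<and>
     (\<exists>xs ys. j # xs @ ys \<in> \<sigma> \<and> Out_verts Q j \<subseteq> set xs \<and> In_verts Q j \<inter> set xs = {}
        \<and> \<sigma>' = cyclic_class (xs @ j # ys)))"

text \<open>At most one of the two terms of an entry is nonzero, as a quiver has no 2-cycles.\<close>

definition exchange_matrix :: "'v quiver \<Rightarrow> 'v list \<Rightarrow> int mat" where
  "exchange_matrix Q vs = mat (length vs) (length vs)
     (\<lambda>(i, j). int (arr Q (vs ! i) (vs ! j)) - int (arr Q (vs ! j) (vs ! i)))"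

definition unipotent_upper_triangular :: "int mat \<Rightarrow> bool" where
  "unipotent_upper_triangular U \<longleftrightarrow>
     square_mat U \<and> upper_triangular U \<and> (\<forall>i < dim_row U. U $$ (i, i) = 1)"

definition is_unipotent_companion :: "'v quiver \<Rightarrow> 'v list \<Rightarrow> int mat \<Rightarrow> bool" where
  "is_unipotent_companion Q vs U \<longleftrightarrow>
     U \<in> carrier_mat (length vs) (length vs) \<and> unipotent_upper_triangular U
     \<and> - exchange_matrix Q vs = U - U\<^sup>T"

lemma is_unipotent_companion_ex1: "\<exists>!U. is_unipotent_companion Q vs U"
proof
  let ?n = "length vs" and ?B = "exchange_matrix Q vs"
  let ?U = "mat ?n ?n (\<lambda>(i, j). if i = j then 1 else if i < j then - ?B $$ (i, j) else 0)"
  have "- ?B = ?U - ?U\<^sup>T"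
    by (rule eq_matI) (auto simp: exchange_matrix_def)
  then show "is_unipotent_companion Q vs ?U"
    by (auto simp: is_unipotent_companion_def unipotent_upper_triangular_def upper_triangular_def)
  fix U assume U: "is_unipotent_companion Q vs U"
  then have d: "dim_row U = ?n" "dim_col U = ?n"
    by (auto simp: is_unipotent_companion_def)
  have e: "- ?B = U - U\<^sup>T" and t: "\<And>i j. j < i \<Longrightarrow> i < ?n \<Longrightarrow> U $$ (i, j) = 0"
    and o: "\<And>i. i < ?n \<Longrightarrow> U $$ (i, i) = 1"
    using U d by (auto simp: is_unipotent_companion_def unipotent_upper_triangular_def
        upper_triangular_def)
  show "U = ?U"
  proof (rule eq_matI)
    fix i j assume "i < dim_row ?U" "j < dim_col ?U"
    then have ij: "i < ?n" "j < ?n" by auto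
    have "(- ?B) $$ (i, j) = (U - U\<^sup>T) $$ (i, j)" using e by simp
    then have "- (?B $$ (i, j)) = U $$ (i, j) - U $$ (j, i)"
      using ij d by (simp add: exchange_matrix_def)
    then show "U $$ (i, j) = ?U $$ (i, j)"
      using ij t[of i j] t[of j i] o[of i] by (cases i j rule: linorder_cases) auto
  qed (use d in auto)
qed

lemma is_quiver_mutate:
  assumes "is_quiver Q" "j \<in> verts Q"
  shows "is_quiver (mutate j Q)"
proof -
  have v: "arr Q i k = 0" if "i \<notin> verts Q \<or> k \<notin> verts Q" for i k
    using assms that by (auto simp: is_quiver_def)
  have a: "arr (mutate j Q) i k = (if i = j \<or> k = j then arr Q k i - arr Q i k
      else (arr Q i k + arr Q i j * arr Q j k) - (arr Q k i + arr Q k j * arr Q j i))" for i k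
    using assms(1)
    by (auto simp: is_quiver_def mutate_def cancel_2cycles_def reverse_at_def add_paths_def)
  have vs: "verts (mutate j Q) = verts Q"
    by (simp add: mutate_def cancel_2cycles_def reverse_at_def add_paths_def)
  show ?thesis
    unfolding is_quiver_def vs
  proof (intro conjI allI impI)
    show "finite (verts Q)" using assms by (simp add: is_quiver_def)
    show "arr (mutate j Q) i i = 0" for i by (simp add: a)
    show "arr (mutate j Q) k i = 0" if "arr (mutate j Q) i k > 0" for i k
      using that unfolding a by (auto split: if_splits)
    show "i \<in> verts Q" if "arr (mutate j Q) i k > 0" for i k
      proof (rule ccontr)
      assume "i \<notin> verts Q"
      then show False using that v[of i k] v[of k i] v[of i j] v[of j i] unfolding a by (simp split: if_splits)
    qed
    show "k \<in> verts Q" if "arr (mutate j Q) i k > 0" for i k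
      proof (rule ccontr)
      assume "k \<notin> verts Q"
      then show False using that v[of i k] v[of k i] v[of k j] v[of j k] unfolding a by (simp split: if_splits)
    qed
  qed
qed

end

theory Submission
  imports Defs
begin

text \<open>Regard the unipotent companion \<open>U\<close> as the bilinear form \<open>u\<close> on \<open>\<int>\<^sup>V\<close>; the choice of a
  linear ordering then enters only through the values of \<open>u\<close>. For \<open>j\<close> the first vertex, so that
  \<open>u(i, j) = 0\<close> for \<open>i \<noteq> j\<close>, and a set \<open>S\<close> of other vertices, replace \<open>e\<^sub>i\<close> by
  \<open>e\<^sub>i - u(j, i) e\<^sub>j\<close> for \<open>i \<in> S\<close>. With \<open>S\<close> everything but \<open>j\<close>, this moves \<open>j\<close> from the first to
  the last position, which gives independence of the compatible linear ordering. With \<open>S\<close> the set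
  of vertices that \<open>j\<close> passes, followed by \<open>e\<^sub>j \<mapsto> - e\<^sub>j\<close>, it is the proper mutation at \<open>j\<close>: the
  correction \<open>- u(j, i) u(j, k)\<close> for \<open>i \<in> S\<close>, \<open>k \<notin> S\<close> counts the paths \<open>k \<rightarrow> j \<rightarrow> i\<close>. A wiggle
  does not change \<open>u\<close> at all.\<close>

section \<open>Integral congruence as an equivalence relation\<close>

text \<open>Over \<open>int\<close>, \<open>invertible_mat\<close> asks for an integer inverse, so
  \<open>G\<close> ranges over GL_n(Z).\<close>

definition int_congruent :: "nat \<Rightarrow> int mat \<Rightarrow> int mat \<Rightarrow> bool" where
  "int_congruent n A B \<longleftrightarrow>
     (\<exists>G. G \<in> carrier_mat n n \<and> invertible_mat G \<and> B = G * A * G\<^sup>T)"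

lemma int_congruentI:
  assumes "G \<in> carrier_mat n n" "H \<in> carrier_mat n n" "G * H = 1\<^sub>m n" "H * G = 1\<^sub>m n"
    and "B = G * A * G\<^sup>T"
  shows "int_congruent n A B"
proof -
  have "invertible_mat G"
    using assms(1-4) unfolding invertible_mat_def inverts_mat_def by auto
  with assms(1,5) show ?thesis unfolding int_congruent_def by blast
qed

lemma int_congruentE:
  assumes "int_congruent n A B"
  obtains G H where "G \<in> carrier_mat n n" "H \<in> carrier_mat n n" "G * H = 1\<^sub>m n" "H * G = 1\<^sub>m n"
    and "B = G * A * G\<^sup>T"
proof -
  obtain G H where G: "G \<in> carrier_mat n n" "B = G * A * G\<^sup>T"
    and GH: "G * H = 1\<^sub>m n" and HG: "H * G = 1\<^sub>m (dim_row H)"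
    using assms unfolding int_congruent_def invertible_mat_def inverts_mat_def by auto
  \<comment> \<open>\<open>invertible_mat\<close> does not fix the shape of the inverse; the two
    products force \<open>H\<close> to be square of size \<open>n\<close>.\<close>
  have "dim_col (G * H) = n" "dim_col (H * G) = dim_row H" using GH HG by auto
  then have "H \<in> carrier_mat n n" using G(1) by auto
  with G GH HG show thesis using that by auto
qed

lemma int_congruent_sym:
  assumes "int_congruent n A B" and A: "A \<in> carrier_mat n n"
  shows "int_congruent n B A"
proof -
  obtain G H where G: "G \<in> carrier_mat n n" and H: "H \<in> carrier_mat n n"
    and GH: "G * H = 1\<^sub>m n" and HG: "H * G = 1\<^sub>m n" and B: "B = G * A * G\<^sup>T"
    using assms(1) by (rule int_congruentE)
  have "G\<^sup>T * H\<^sup>T = 1\<^sub>m n"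
    using transpose_mult[OF H G] HG by simp
  moreover have "H * (G * A * G\<^sup>T) * H\<^sup>T = (H * G) * A * (G\<^sup>T * H\<^sup>T)"
    using G H A by (simp add: assoc_mult_mat[where n\<^sub>1 = n and n\<^sub>2 = n and n\<^sub>3 = n and n\<^sub>4 = n])
  ultimately have "A = H * B * H\<^sup>T"
    using HG A B by simp
  then show ?thesis using int_congruentI[OF H G HG GH] by blast
qed

lemma int_congruent_trans:
  assumes "int_congruent n A B" "int_congruent n B C" and A: "A \<in> carrier_mat n n"
  shows "int_congruent n A C"
proof -
  obtain G H where G: "G \<in> carrier_mat n n" and H: "H \<in> carrier_mat n n"
    and GH: "G * H = 1\<^sub>m n" and HG: "H * G = 1\<^sub>m n" and B: "B = G * A * G\<^sup>T"
    using assms(1) by (rule int_congruentE)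
  obtain K L where K: "K \<in> carrier_mat n n" and L: "L \<in> carrier_mat n n"
    and KL: "K * L = 1\<^sub>m n" and LK: "L * K = 1\<^sub>m n" and C: "C = K * B * K\<^sup>T"
    using assms(2) by (rule int_congruentE)
  note assoc = assoc_mult_mat[where n\<^sub>1 = n and n\<^sub>2 = n and n\<^sub>3 = n and n\<^sub>4 = n]
  have "(K * G) * (H * L) = K * ((G * H) * L)" "(H * L) * (K * G) = H * ((L * K) * G)"
    using G H K L by (simp_all add: assoc)
  then have inv: "(K * G) * (H * L) = 1\<^sub>m n" "(H * L) * (K * G) = 1\<^sub>m n"
    using G H K L GH HG KL LK by simp_all
  have "C = (K * G) * A * (K * G)\<^sup>T"
    unfolding C B transpose_mult[OF K G] using G K A by (simp add: assoc)
  then show ?thesis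
    using int_congruentI[OF _ _ inv] G H K L by (meson mult_carrier_mat)
qed

section \<open>Bilinear forms indexed by vertices, and their change of basis\<close>

text \<open>Entries depend on vertices, not positions, and rows and columns have separate lists. A
  base change can thus go from one ordering to another without permutation matrices.\<close>

definition vmat :: "'v list \<Rightarrow> 'v list \<Rightarrow> ('v \<Rightarrow> 'v \<Rightarrow> int) \<Rightarrow> int mat" where
  "vmat us vs F = mat (length us) (length vs) (\<lambda>(i, k). F (us ! i) (vs ! k))"

lemma vmat_carrier [simp]: "vmat us vs F \<in> carrier_mat (length us) (length vs)"
  by (simp add: vmat_def)

lemma vmat_cong:
  assumes "\<And>a b. a \<in> set us \<Longrightarrow> b \<in> set vs \<Longrightarrow> F a b = G a b"
  shows "vmat us vs F = vmat us vs G"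
  using assms by (auto simp: vmat_def intro!: cong_mat)

lemma vmat_transpose: "(vmat us vs F)\<^sup>T = vmat vs us (\<lambda>a b. F b a)"
  by (rule eq_matI) (auto simp: vmat_def)

lemma vmat_one: "distinct us \<Longrightarrow> vmat us us (\<lambda>a b. if a = b then 1 else 0) = 1\<^sub>m (length us)"
  by (rule eq_matI) (auto simp: vmat_def nth_eq_iff_index_eq)

lemma vmat_mult:
  assumes "distinct vs"
  shows "vmat us vs F * vmat vs ws G = vmat us ws (\<lambda>a c. \<Sum>b\<in>set vs. F a b * G b c)"
proof -
  have "bij_betw ((!) vs) {0..<length vs} (set vs)"
    using bij_betw_nth[OF assms refl refl] by (simp add: atLeast0LessThan)
  then have "(\<Sum>k = 0..<length vs. F a (vs ! k) * G (vs ! k) c) = (\<Sum>b\<in>set vs. F a b * G b c)"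
    for a c by (rule sum.reindex_bij_betw)
  then show ?thesis
    by (intro eq_matI) (auto simp: vmat_def scalar_prod_def)
qed

text \<open>The change of basis is \<open>e\<^sub>a' = s\<^sub>a e\<^sub>a + t\<^sub>a e\<^sub>j\<close>.\<close>

lemma int_congruent_vmat:
  fixes f g :: "'v \<Rightarrow> 'v \<Rightarrow> int" and s t :: "'v \<Rightarrow> int"
  assumes d: "distinct vs" "distinct vs'" and set: "set vs' = set vs" and j: "j \<in> set vs"
    and s: "\<And>a. s a * s a = 1" and t: "t j = 0"
    and g: "\<And>a b. a \<in> set vs \<Longrightarrow> b \<in> set vs \<Longrightarrow>
      g a b = s b * (s a * f a b + t a * f j b) + t b * (s a * f a j + t a * f j j)"
  shows "int_congruent (length vs) (vmat vs vs f) (vmat vs' vs' g)"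
proof -
  define G where "G a c = (if a = c then s a else 0) + (if j = c then t a else 0)" for a c
  \<comment> \<open>The inverse base change: \<open>t j = 0\<close> gives e_j = s_j e_j', and
    solving for e_a yields e_a = s_a e_a' - s_a t_a s_j e_j'.\<close>
  define H where "H a c = (if a = c then s a else 0) + (if j = c then - s a * t a * s j else 0)"
    for a c
  have len: "length vs' = length vs" using d set by (metis distinct_card)
  have G_sum: "(\<Sum>c\<in>set vs. G a c * F c) = s a * F a + t a * F j" if "a \<in> set vs" for a F
    using that j by (simp add: G_def distrib_right sum.distrib if_distrib[of "\<lambda>x. x * _"]
        cong: if_cong)
  have H_sum: "(\<Sum>c\<in>set vs. H a c * F c) = s a * F a - s a * t a * s j * F j"
    if "a \<in> set vs" for a F
    using that j by (simp add: H_def distrib_right sum.distrib if_distrib[of "\<lambda>x. x * _"]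
        cong: if_cong)
  have s': "s a * (s a * x) = x" "s a * (x * s a) = x" for a x
    using s[of a] by (metis mult.assoc mult.commute mult_1)+
  have GH: "vmat vs' vs G * vmat vs vs' H = 1\<^sub>m (length vs)"
    unfolding vmat_mult[OF d(1)] vmat_one[OF d(2), unfolded len, symmetric]
    by (rule vmat_cong) (auto simp: set G_sum, auto simp: H_def t s s' algebra_simps)
  have HG: "vmat vs vs' H * vmat vs' vs G = 1\<^sub>m (length vs)"
    unfolding vmat_mult[OF d(2)] vmat_one[OF d(1), symmetric]
    by (rule vmat_cong) (auto simp: set H_sum, auto simp: G_def t s s' algebra_simps split: if_splits)
  have "vmat vs' vs' g = vmat vs' vs G * vmat vs vs f * (vmat vs' vs G)\<^sup>T"
    unfolding vmat_transpose vmat_mult[OF d(1)]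
  proof (rule vmat_cong)
    fix a b assume "a \<in> set vs'" "b \<in> set vs'"
    then have ab: "a \<in> set vs" "b \<in> set vs" using set by auto
    have "(\<Sum>d\<in>set vs. (\<Sum>c\<in>set vs. G a c * f c d) * G b d)
        = (\<Sum>d\<in>set vs. G b d * (s a * f a d + t a * f j d))"
      using ab by (simp add: G_sum mult.commute)
    then show "g a b = (\<Sum>d\<in>set vs. (\<Sum>c\<in>set vs. G a c * f c d) * G b d)"
      using ab by (simp add: G_sum g)
  qed
  then show ?thesis
    using int_congruentI[OF _ _ GH HG] vmat_carrier len by metis
qed

section \<open>The unipotent companion as a bilinear form\<close>

text \<open>The recursive form gives a rule for appended lists, by which the order after moving a
  vertex is computed without indices.\<close>

fun precedes :: "'v list \<Rightarrow> 'v \<Rightarrow> 'v \<Rightarrow> bool" where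
  "precedes [] a b \<longleftrightarrow> False"
| "precedes (x # xs) a b \<longleftrightarrow> x = a \<and> b \<in> set xs \<or> precedes xs a b"

lemma precedes_append:
  "precedes (xs @ ys) a b \<longleftrightarrow> precedes xs a b \<or> precedes ys a b \<or> a \<in> set xs \<and> b \<in> set ys"
  by (induction xs) auto

lemma precedes_in_set: "precedes vs a b \<Longrightarrow> a \<in> set vs \<and> b \<in> set vs"
  by (induction vs) auto

lemma precedes_nth:
  assumes "distinct vs" "i < length vs" "k < length vs"
  shows "precedes vs (vs ! i) (vs ! k) \<longleftrightarrow> i < k"
  using assms
proof (induction vs arbitrary: i k)
  case (Cons x xs)
  then show ?case
    by (cases i; cases k) (auto dest: precedes_in_set)
qed simp

text \<open>Above the diagonal the value is minus the exchange matrix entry, since U - U^T =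
  -B.\<close>

definition companion_form :: "'v quiver \<Rightarrow> 'v list \<Rightarrow> 'v \<Rightarrow> 'v \<Rightarrow> int" where
  "companion_form Q vs a b = (if a = b then 1
     else if precedes vs a b then int (arr Q b a) - int (arr Q a b) else 0)"

definition companion :: "'v quiver \<Rightarrow> 'v list \<Rightarrow> int mat" where
  "companion Q vs = vmat vs vs (companion_form Q vs)"

lemma companion_carrier [simp]: "companion Q vs \<in> carrier_mat (length vs) (length vs)"
  by (simp add: companion_def)

lemma is_unipotent_companion_unique:
  assumes "distinct vs" "is_unipotent_companion Q vs U"
  shows "U = companion Q vs"
proof -
  have "is_unipotent_companion Q vs (companion Q vs)"
    unfolding is_unipotent_companion_def unipotent_upper_triangular_def upper_triangular_def
    using assms(1)
    by (auto intro!: eq_matI simp: companion_def vmat_def companion_form_def exchange_matrix_def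
        precedes_nth nth_eq_iff_index_eq)
  then show ?thesis
    using is_unipotent_companion_ex1[of Q vs] assms(2) by blast
qed

section \<open>Cyclic shifts of the linear ordering\<close>

text \<open>Let u be the form for \<open>v # ws\<close>. The new value at (v, a) is u(v, a) - u(v,
  a) = 0, and at (a, v) it is -u(v, a). For a, b other than v the corrections -u(v, a) u(v, b) and
  +u(v, a) u(v, b) cancel.\<close>

lemma companion_move_last:
  assumes "distinct (v # ws)"
  shows "int_congruent (Suc (length ws)) (companion Q (v # ws)) (companion Q (ws @ [v]))"
proof -
  have "int_congruent (length (v # ws)) (companion Q (v # ws)) (companion Q (ws @ [v]))"
    unfolding companion_def
    by (rule int_congruent_vmat[where j = v and s = "\<lambda>_. 1"
          and t = "\<lambda>a. if a = v then 0 else - companion_form Q (v # ws) v a"])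
      (use assms in \<open>auto simp: companion_form_def precedes_append algebra_simps
          dest: precedes_in_set\<close>)
  then show ?thesis by simp
qed

lemma companion_rotate:
  assumes "distinct vs"
  shows "int_congruent (length vs) (companion Q vs) (companion Q (rotate m vs))"
proof (induction m)
  case 0
  have "companion Q vs = 1\<^sub>m (length vs) * companion Q vs * (1\<^sub>m (length vs))\<^sup>T"
    by (simp add: left_mult_one_mat[OF companion_carrier] right_mult_one_mat[OF companion_carrier])
  then show ?case
    by (intro int_congruentI[of "1\<^sub>m (length vs)" _ "1\<^sub>m (length vs)"]) simp_all
next
  case (Suc m)
  have "int_congruent (length vs) (companion Q (rotate m vs)) (companion Q (rotate (Suc m) vs))"
  proof (cases "rotate m vs")
    case Nil
    then show ?thesis using Suc by simp
  next
    case (Cons v ws)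
    then have "distinct (v # ws)" "length vs = Suc (length ws)"
      using assms by (metis distinct_rotate) (metis Cons length_Cons length_rotate)
    then show ?thesis using companion_move_last[of v ws Q] Cons by simp
  qed
  then show ?case using Suc int_congruent_trans companion_carrier by blast
qed

lemma cyclic_class_refl: "vs \<in> cyclic_class vs"
  unfolding cyclic_class_def by (auto intro: exI[of _ 0])

lemma cyclic_class_invariants:
  assumes "vs \<in> cyclic_class ws"
  shows "set vs = set ws" "distinct vs \<longleftrightarrow> distinct ws" "length vs = length ws"
  using assms by (auto simp: cyclic_class_def)

lemma companion_cyclic_class:
  assumes "distinct ws" "us \<in> cyclic_class ws" "vs \<in> cyclic_class ws"
  shows "int_congruent (length ws) (companion Q us) (companion Q vs)"
proof -
  have "int_congruent (length ws) (companion Q ws) (companion Q us)"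
    "int_congruent (length ws) (companion Q ws) (companion Q vs)"
    using assms companion_rotate unfolding cyclic_class_def by auto
  moreover have "companion Q us \<in> carrier_mat (length ws) (length ws)"
    using cyclic_class_invariants(3)[OF assms(2)] companion_carrier by metis
  ultimately show ?thesis
    using int_congruent_sym int_congruent_trans companion_carrier by blast
qed

section \<open>Wiggles and proper mutations\<close>

text \<open>Only the order of \<open>u\<close> and \<open>v\<close> changes, and the form vanishes
  on this pair in either order. The base change is the identity.\<close>

lemma companion_swap:
  assumes "distinct (u # v # ws)" "arr Q u v = 0" "arr Q v u = 0"
  shows "int_congruent (length (u # v # ws)) (companion Q (u # v # ws)) (companion Q (v # u # ws))"
  unfolding companion_def
  by (rule int_congruent_vmat[where j = u and s = "\<lambda>_. 1" and t = "\<lambda>_. 0"])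
    (use assms in \<open>auto simp: companion_form_def\<close>)

text \<open>Cancelling 2-cycles preserves the net number of arrows, so truncated subtraction
  disappears from the difference.\<close>

lemma arr_mutate:
  assumes "is_quiver Q"
  shows "int (arr (mutate j Q) i k) - int (arr (mutate j Q) k i) =
    (if i = j \<or> k = j then int (arr Q k i) - int (arr Q i k)
     else int (arr Q i k) - int (arr Q k i)
       + int (arr Q i j) * int (arr Q j k) - int (arr Q k j) * int (arr Q j i))"
proof -
  have "int (x - y) - int (y - x) = int x - int y" for x y :: nat by linarith
  then show ?thesis
    using assms
    by (auto simp: is_quiver_def mutate_def cancel_2cycles_def reverse_at_def add_paths_def)
qed

lemma companion_mutate:
  assumes Q: "is_quiver Q" and d: "distinct (j # xs @ ys)" and V: "set (j # xs @ ys) = verts Q"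
    and Out: "Out_verts Q j \<subseteq> set xs" and In: "In_verts Q j \<inter> set xs = {}"
  shows "int_congruent (length (j # xs @ ys)) (companion Q (j # xs @ ys))
    (companion (mutate j Q) (xs @ j # ys))"
proof -
  \<comment> \<open>Between \<open>j\<close> and \<open>xs\<close> all arrows leave
    \<open>j\<close>; between \<open>j\<close> and \<open>ys\<close> all arrows enter
    \<open>j\<close>. Paths through \<open>j\<close> therefore only go from \<open>ys\<close> to
    \<open>xs\<close>.\<close>
  have In0: "arr Q a j = 0" if "a \<in> set xs" for a
    using that V In by (auto simp: In_verts_def)
  have Out0: "arr Q j a = 0" if "a \<in> set ys" for a
    using that V Out d by (auto simp: Out_verts_def)
  have not_precedes: "\<not> precedes zs a j" "\<not> precedes zs j a" if "zs = xs \<or> zs = ys" for zs a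
    using that d precedes_in_set[of zs] by auto
  let ?f = "companion_form Q (j # xs @ ys)" and ?g = "companion_form (mutate j Q) (xs @ j # ys)"
  \<comment> \<open>The sign at \<open>j\<close> reverses its arrows; \<open>?t\<close> shears only
    along the vertices that \<open>j\<close> passes.\<close>
  let ?s = "\<lambda>a. if a = j then - 1 else 1 :: int"
    and ?t = "\<lambda>a. if a \<in> set xs then - ?f j a else 0"
  have fj: "?f j a = (if a \<in> set xs then - int (arr Q j a) else int (arr Q a j))"
    and gj: "?g j a = (if a \<in> set xs then 0 else - int (arr Q a j))"
      "?g a j = (if a \<in> set xs then - int (arr Q j a) else 0)"
    and f0: "?f a j = 0"
    if "a \<in> set xs \<or> a \<in> set ys" for a
    using that d
    by (auto simp: companion_form_def precedes_append not_precedes In0 Out0 arr_mutate[OF Q])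
  have f1: "?f j j = 1" "?g j j = 1" by (simp_all add: companion_form_def)
  \<comment> \<open>For \<open>a\<close> in \<open>xs\<close> and \<open>b\<close> in
    \<open>ys\<close> mutation adds the paths from \<open>b\<close> through \<open>j\<close> to
    \<open>a\<close>. For the opposite order both forms vanish, and within \<open>xs\<close> or
    within \<open>ys\<close> there is no path through \<open>j\<close>.\<close>
  have gab: "?g a b = ?f a b - (if a \<in> set xs \<and> b \<in> set ys then
      int (arr Q b j) * - int (arr Q j a) else 0)"
    if "a \<in> set xs \<or> a \<in> set ys" "b \<in> set xs \<or> b \<in> set ys" for a b
  proof -
    have j: "a \<noteq> j" "b \<noteq> j" using that d by auto
    then have p: "precedes (xs @ j # ys) a b = precedes (xs @ ys) a b"
      "precedes (j # xs @ ys) a b = precedes (xs @ ys) a b"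
      by (auto simp: precedes_append)
    have "a \<in> set xs \<Longrightarrow> b \<in> set ys \<Longrightarrow> a \<noteq> b \<and> precedes (xs @ ys) a b"
      using d by (auto simp: precedes_append)
    moreover have "a \<in> set ys \<Longrightarrow> b \<in> set xs \<Longrightarrow> \<not> precedes (xs @ ys) a b"
      using d by (auto simp: precedes_append dest: precedes_in_set)
    ultimately show ?thesis
      using that j d
      by (cases "a \<in> set xs"; cases "b \<in> set xs")
        (auto simp: companion_form_def p arr_mutate[OF Q] In0 Out0)
  qed
  show ?thesis
    unfolding companion_def
  proof (rule int_congruent_vmat[where j = j and s = ?s and t = ?t])
    fix a b assume ab: "a \<in> set (j # xs @ ys)" "b \<in> set (j # xs @ ys)"
    have neq: "a \<noteq> j" if "a \<in> set xs \<or> a \<in> set ys" for a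
      using that d by auto
    consider "a = j" "b = j" | "a = j" "b \<in> set xs \<or> b \<in> set ys"
      | "a \<in> set xs \<or> a \<in> set ys" "b = j"
      | "a \<in> set xs \<or> a \<in> set ys" "b \<in> set xs \<or> b \<in> set ys"
      using ab by auto
    then show "?g a b = ?s b * (?s a * ?f a b + ?t a * ?f j b)
        + ?t b * (?s a * ?f a j + ?t a * ?f j j)"
    proof cases
      case 1
      then show ?thesis using d by (simp add: f1)
    next
      case 2
      then show ?thesis using d neq[of b] by (simp add: fj gj f1)
    next
      case 3
      then show ?thesis using d neq[of a] by (simp add: fj gj f0 f1)
    next
      case 4
      then show ?thesis
        using d neq[of a] neq[of b] by (auto simp: gab fj f0 f1 Out0 In0)
    qed
  qed (use d in auto)
qed

theorem theorem7p1:
  fixes Q Q' :: "'v quiver" and \<sigma> \<sigma>' :: "'v list set" and vs vs' :: "'v list"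
    and U U' :: "int mat" and n :: nat
  assumes "is_coq (Q, \<sigma>)" and "card (verts Q) = n"
    and "wiggle (Q, \<sigma>) (Q', \<sigma>') \<or> (\<exists>j. proper_mutation j (Q, \<sigma>) (Q', \<sigma>'))"
    and "vs \<in> \<sigma>" and "is_unipotent_companion Q vs U"
    and "vs' \<in> \<sigma>'" and "is_unipotent_companion Q' vs' U'"
  shows "\<exists>G :: int mat. G \<in> carrier_mat n n \<and> invertible_mat G \<and> U' = G * U * G\<^sup>T"
proof -
  obtain ws where Q: "is_quiver Q" and ws: "distinct ws" "set ws = verts Q"
    and \<sigma>: "\<sigma> = cyclic_class ws"
    using assms(1) by (auto simp: is_coq_def cyclic_ordering_def linear_ordering_def)
  have n: "length ws = n" using ws assms(2) by (metis distinct_card)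
  \<comment> \<open>Wiggles and mutations are explicit only for particular representatives
    \<open>us\<close> and \<open>us'\<close>; cyclic shifts then link these to \<open>vs\<close> and
    \<open>vs'\<close>.\<close>
  obtain us us' where us: "us \<in> \<sigma>" and \<sigma>': "\<sigma>' = cyclic_class us'"
    and us': "distinct us'" "length us' = n"
    and step: "int_congruent n (companion Q us) (companion Q' us')"
    using assms(3)
  proof
    assume "wiggle (Q, \<sigma>) (Q', \<sigma>')"
    then obtain u v zs where uv: "u # v # zs \<in> \<sigma>" "arr Q u v = 0" "arr Q v u = 0"
      and Q': "Q' = Q" and \<sigma>': "\<sigma>' = cyclic_class (v # u # zs)"
      by (auto simp: wiggle_def)
    have "distinct (u # v # zs)" "length (u # v # zs) = n"
      using cyclic_class_invariants[of "u # v # zs" ws] uv(1) ws n \<sigma> by auto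
    then show thesis
      using that[OF uv(1) \<sigma>'] companion_swap[of u v zs Q] uv Q' by auto
  next
    assume "\<exists>j. proper_mutation j (Q, \<sigma>) (Q', \<sigma>')"
    then obtain j xs ys where xy: "j # xs @ ys \<in> \<sigma>" and Q': "Q' = mutate j Q"
      and io: "Out_verts Q j \<subseteq> set xs" "In_verts Q j \<inter> set xs = {}"
      and \<sigma>': "\<sigma>' = cyclic_class (xs @ j # ys)"
      by (auto simp: proper_mutation_def)
    have d: "distinct (j # xs @ ys)" "set (j # xs @ ys) = verts Q" "length (j # xs @ ys) = n"
      using cyclic_class_invariants[of "j # xs @ ys" ws] xy ws n \<sigma> by auto
    then show thesis
      using that[OF xy \<sigma>'] companion_mutate[OF Q d(1,2) io] Q' by auto
  qed
  have vs: "distinct vs" "length vs = n" "length us = n"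
    using cyclic_class_invariants assms(4) us ws n \<sigma> by metis+
  have "distinct vs'" using cyclic_class_invariants(2) assms(6) us' \<sigma>' by metis
  then have U: "U = companion Q vs" "U' = companion Q' vs'"
    using is_unipotent_companion_unique assms(5,7) vs(1) by blast+
  have "int_congruent n (companion Q vs) (companion Q us)"
    using companion_cyclic_class[OF ws(1)] assms(4) us n \<sigma> by metis
  moreover have "int_congruent n (companion Q' us') (companion Q' vs')"
    using companion_cyclic_class[OF us'(1) cyclic_class_refl] assms(6) us' \<sigma>' by metis
  ultimately have "int_congruent n U U'"
    unfolding U using int_congruent_trans step vs companion_carrier by metis
  then show ?thesis by (simp add: int_congruent_def)
qed

end
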